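(* Let $n \geq 4$ be an integer and let $P(x) = \sum_{k=0}^n a_k x^k$ be a real polynomial with $a_k > 0$ for all $k = 0, 1, \ldots, n$. Suppose that there exists a real number $\alpha$ with $1 + \sqrt{5} \leq \alpha < 4$ such that $$q_k(P) \in \left[\alpha, \frac{8}{\alpha(4 - \alpha)}\right] \quad \text{for all } k = 2, 3, \ldots, n.$$ Then $P$ is hyperbolic, i.e. all the zeros of $P$ are real.
   Context: For a polynomial $P(x)=\sum_{k=0}^n a_k x^k$ with nonzero real coefficients, the second quotients of its coefficients are $q_k(P) := \frac{a_{k-1}^2}{a_{k-2}a_k}$ for $2 \leq k \leq n$. A real polynomial is called hyperbolic if all its (complex) zeros are real. *)

theory Defs
  imports Complex_Main "HOL-Computational_Algebra.Polynomial"
begin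

text \<open>Meaningful only for \<open>2 \<le> k \<le> degree P\<close> with nonzero coefficients; for \<open>k < 2\<close> the
  subtraction on the natural numbers truncates.\<close>
definition second_quotient :: "real poly \<Rightarrow> nat \<Rightarrow> real" where
  "second_quotient P k = (coeff P (k - 1))\<^sup>2 / (coeff P (k - 2) * coeff P k)"

definition hyperbolic :: "real poly \<Rightarrow> bool" where
  "hyperbolic P \<longleftrightarrow> (\<forall>z::complex. poly (map_poly complex_of_real P) z = 0 \<longrightarrow> z \<in> \<real>)"

end

theory Submission
  imports Defs
begin

text \<open>
  With \<open>a\<^sub>k\<close> the coefficients of \<open>P\<close> and \<open>p\<^sub>k = a\<^sub>k\<^sub>-\<^sub>1 / a\<^sub>k\<close>, the polynomial \<open>P(-x)\<close> has sign \<open>(-1)\<^sup>k\<close>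
  at points \<open>0 = y\<^sub>0 < \<dots> < y\<^sub>n\<^sub>-\<^sub>1\<close>. For \<open>2 \<le> k \<le> n - 2\<close> the geometric mean
  \<open>y\<^sub>k = sqrt (p\<^sub>k p\<^sub>k\<^sub>+\<^sub>1)\<close> works: there the terms of index \<open>k - 2, \<dots>, k + 2\<close> dominate. The critical point
  is \<open>y\<^sub>1 = u p\<^sub>2\<close> (and, by reversing the coefficients, \<open>y\<^sub>n\<^sub>-\<^sub>1\<close>): the extremal quotients
  \<open>q\<^sub>2 = \<alpha>\<close>, \<open>q\<^sub>3 = \<beta>\<close>, \<open>q\<^sub>4 = \<alpha>\<close> give a quartic in \<open>u = x / p\<^sub>2\<close>, palindromic up to scaling, which for \<open>\<beta> = 8 / (\<alpha> (4 - \<alpha>))\<close> is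
  minus the square of a quadratic, and \<open>u\<close> is its double zero below \<open>1\<close>. A nonreal zero of \<open>P\<close> would give a factor
  that is positive on the real line and a cofactor of degree \<open>n - 2\<close> with the same \<open>n - 1\<close> sign changes.
  Strictness of the sign at \<open>y\<^sub>1\<close> and \<open>y\<^sub>n\<^sub>-\<^sub>1\<close> fails only for \<open>n = 4\<close>, where the cofactor is a convex parabola
  that is \<open>\<le> 0\<close> at the two ends and positive in between.
\<close>

section \<open>Sequences with bounded second quotients\<close>

text \<open>Denominators are cleared, and the data is a sequence rather than a polynomial, so that
  the condition passes easily to rescaled, reversed and truncated sequences.\<close>

definition quotients_between :: "real \<Rightarrow> real \<Rightarrow> nat \<Rightarrow> (nat \<Rightarrow> real) \<Rightarrow> bool" where
  "quotients_between \<alpha> \<beta> n a \<longleftrightarrow> (\<forall>j\<le>n. 0 < a j) \<and>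
     (\<forall>j. j + 2 \<le> n \<longrightarrow> \<alpha> * (a j * a (j + 2)) \<le> (a (j + 1))\<^sup>2 \<and> (a (j + 1))\<^sup>2 \<le> \<beta> * (a j * a (j + 2)))"

text \<open>For \<open>t j = a j * x ^ j\<close> this is the value at -x of the polynomial with
  coefficients \<open>a\<close>, so \<open>x\<close> can stay positive.\<close>

definition alt_sum :: "nat \<Rightarrow> (nat \<Rightarrow> real) \<Rightarrow> real" where
  "alt_sum n t = (\<Sum>j\<le>n. (-1) ^ j * t j)"

lemma quotients_between_pos: "quotients_between \<alpha> \<beta> n a \<Longrightarrow> j \<le> n \<Longrightarrow> 0 < a j"
  by (simp add: quotients_between_def)

lemma quotients_between_lower:
  "quotients_between \<alpha> \<beta> n a \<Longrightarrow> j + 2 \<le> n \<Longrightarrow> \<alpha> * (a j * a (j + 2)) \<le> (a (j + 1))\<^sup>2"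
  by (simp add: quotients_between_def)

lemma quotients_between_upper:
  "quotients_between \<alpha> \<beta> n a \<Longrightarrow> j + 2 \<le> n \<Longrightarrow> (a (j + 1))\<^sup>2 \<le> \<beta> * (a j * a (j + 2))"
  by (simp add: quotients_between_def)

text \<open>A substitution x -> c x leaves second quotients unchanged. The sign lemmas can therefore
  take the terms \<open>a j * x ^ j\<close> themselves as the sequence.\<close>

lemma quotients_between_scale:
  assumes "quotients_between \<alpha> \<beta> n a" "0 < x"
  shows "quotients_between \<alpha> \<beta> n (\<lambda>j. a j * x ^ j)"
proof -
  have "\<alpha> * (a j * x ^ j * (a (j + 2) * x ^ (j + 2))) \<le> (a (j + 1) * x ^ (j + 1))\<^sup>2
     \<and> (a (j + 1) * x ^ (j + 1))\<^sup>2 \<le> \<beta> * (a j * x ^ j * (a (j + 2) * x ^ (j + 2)))"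
    if "j + 2 \<le> n" for j
  proof -
    have "\<alpha> * (a j * x ^ j * (a (j + 2) * x ^ (j + 2))) = (x ^ (j + 1))\<^sup>2 * (\<alpha> * (a j * a (j + 2)))"
      and "(a (j + 1) * x ^ (j + 1))\<^sup>2 = (x ^ (j + 1))\<^sup>2 * (a (j + 1))\<^sup>2"
      and "\<beta> * (a j * x ^ j * (a (j + 2) * x ^ (j + 2))) = (x ^ (j + 1))\<^sup>2 * (\<beta> * (a j * a (j + 2)))"
      by (simp_all add: power2_eq_square)
    then show ?thesis
      using mult_left_mono[OF quotients_between_lower[OF assms(1) that] zero_le_power2[of "x ^ (j + 1)"]]
        mult_left_mono[OF quotients_between_upper[OF assms(1) that] zero_le_power2[of "x ^ (j + 1)"]]
      by metis
  qed
  moreover have "0 < a j * x ^ j" if "j \<le> n" for j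
    using quotients_between_pos[OF assms(1) that] assms(2) by simp
  ultimately show ?thesis unfolding quotients_between_def by blast
qed

lemma quotients_between_rev:
  assumes "quotients_between \<alpha> \<beta> n a"
  shows "quotients_between \<alpha> \<beta> n (\<lambda>j. a (n - j))"
proof -
  have "\<alpha> * (a (n - j) * a (n - (j + 2))) \<le> (a (n - (j + 1)))\<^sup>2
     \<and> (a (n - (j + 1)))\<^sup>2 \<le> \<beta> * (a (n - j) * a (n - (j + 2)))" if "j + 2 \<le> n" for j
  proof -
    define i where "i = n - (j + 2)"
    have "n - j = i + 2" "n - (j + 1) = i + 1" "n - (j + 2) = i" "i + 2 \<le> n"
      using that by (auto simp: i_def)
    then show ?thesis
      using quotients_between_lower[OF assms, of i] quotients_between_upper[OF assms, of i]
      by (simp only: mult.commute[of "a (i + 2)"])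
  qed
  moreover have "0 < a (n - j)" if "j \<le> n" for j
    using quotients_between_pos[OF assms(1)] by simp
  ultimately show ?thesis unfolding quotients_between_def by blast
qed

lemma quotients_between_shift:
  assumes "quotients_between \<alpha> \<beta> (k + n) a"
  shows "quotients_between \<alpha> \<beta> n (\<lambda>j. a (k + j))"
  using assms unfolding quotients_between_def by (simp add: add.assoc)

lemma quotients_between_take:
  assumes "quotients_between \<alpha> \<beta> (n + k) a"
  shows "quotients_between \<alpha> \<beta> n a"
  using assms unfolding quotients_between_def by simp

section \<open>Alternating sums and their tails\<close>

lemma alt_sum_Suc: "alt_sum (Suc n) t = t 0 - alt_sum n (\<lambda>j. t (Suc j))"
  unfolding alt_sum_def by (subst sum.atMost_Suc_shift) (simp add: sum_negf)

lemma alt_sum_rev: "alt_sum n (\<lambda>j. t (n - j)) = (-1) ^ n * alt_sum n t"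
proof -
  have "alt_sum n (\<lambda>j. t (n - j)) = (\<Sum>j\<le>n. (-1) ^ (n - j) * t j)"
    unfolding alt_sum_def by (rule sum.reindex_bij_witness[of _ "\<lambda>j. n - j" "\<lambda>j. n - j"]) auto
  also have "\<dots> = (-1) ^ n * alt_sum n t"
    unfolding alt_sum_def sum_distrib_left
    by (rule sum.cong) (auto simp: minus_one_power_iff)
  finally show ?thesis .
qed

lemma alt_sum_add:
  "alt_sum (m + Suc n) t = alt_sum m t + (-1) ^ Suc m * alt_sum n (\<lambda>j. t (Suc m + j))"
  by (induction n) (simp_all add: alt_sum_def power_add algebra_simps)

text \<open>Peel off the first term: for m > 0 the rest is positive and at most \<open>f 1\<close>,
  which is at most \<open>f 0 / 9\<close>. Hence the factor 8/9 and the strictness.\<close>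

lemma alt_sum_geometric_bounds:
  assumes "\<And>j. j \<le> m \<Longrightarrow> 0 < f j" "\<And>j. j < m \<Longrightarrow> 9 * f (Suc j) \<le> f j"
  shows "8 / 9 * f 0 \<le> alt_sum m f \<and> alt_sum m f \<le> f 0 \<and> (0 < m \<longrightarrow> alt_sum m f < f 0)"
  using assms
proof (induction m arbitrary: f)
  case 0
  then show ?case using "0.prems"(1)[of 0] by (simp add: alt_sum_def)
next
  case (Suc m)
  have "8 / 9 * f (Suc 0) \<le> alt_sum m (\<lambda>j. f (Suc j)) \<and> alt_sum m (\<lambda>j. f (Suc j)) \<le> f (Suc 0)"
    using Suc.IH[of "\<lambda>j. f (Suc j)"] Suc.prems by simp
  moreover have "9 * f (Suc 0) \<le> f 0" "0 < f (Suc 0)"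
    using Suc.prems by simp_all
  ultimately show ?case by (simp add: alt_sum_Suc)
qed

text \<open>The ratio \<open>s j / s (j + 1)\<close> grows at least by the factor \<alpha> \<ge> 3
  at each step. Being at least 1 at index 0, it is at least 9 from index 2 on.\<close>

lemma alt_sum_tail_bounds:
  assumes q: "quotients_between \<alpha> \<beta> (m + 2) s" and "3 \<le> \<alpha>" and "s 1 \<le> s 0"
  shows "8 / 9 * s 2 \<le> alt_sum m (\<lambda>j. s (j + 2))"
    and "alt_sum m (\<lambda>j. s (j + 2)) \<le> s 2"
    and "0 < m \<Longrightarrow> alt_sum m (\<lambda>j. s (j + 2)) < s 2"
proof -
  \<comment> \<open>\<open>c\<close> bounds one ratio from below, and \<open>3 * c\<close> then
    bounds the next.\<close>
  have step: "3 * c * s (j + 2) \<le> s (j + 1)"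
    if j: "j + 2 \<le> m + 2" and c: "c * s (j + 1) \<le> s j" and c1: "1 \<le> c" for j c
  proof -
    have p: "0 < s j" "0 < s (j + 1)" "0 < s (j + 2)"
      using quotients_between_pos[OF q] j by auto
    have "s (j + 1) * (3 * c * s (j + 2)) = 3 * (c * s (j + 1)) * s (j + 2)" by simp
    also have "\<dots> \<le> 3 * s j * s (j + 2)" using c p by simp
    also have "\<dots> \<le> \<alpha> * (s j * s (j + 2))" using \<open>3 \<le> \<alpha>\<close> p by simp
    also have "\<dots> \<le> s (j + 1) * s (j + 1)"
      using quotients_between_lower[OF q j] by (simp add: power2_eq_square)
    finally show ?thesis using p by simp
  qed
  have "9 * s (j + 3) \<le> s (j + 2)" if "j < m" for j
    using that
  proof (induction j)
    case 0
    have "3 * s 2 \<le> s 1"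
      using step[of 0 1] \<open>s 1 \<le> s 0\<close> by (simp add: numeral_2_eq_2)
    then show ?case using step[of 1 3] 0 by (simp add: numeral_2_eq_2 numeral_3_eq_3)
  next
    case (Suc j)
    have "0 < s (j + 3)" "9 * s (j + 3) \<le> s (j + 2)"
      using quotients_between_pos[OF q, of "j + 3"] Suc by auto
    then show ?case using step[of "j + 2" 3] Suc.prems
      by (simp add: numeral_2_eq_2 numeral_3_eq_3)
  qed
  then have "\<And>j. j < m \<Longrightarrow> 9 * s (Suc j + 2) \<le> s (j + 2)"
    by (simp add: numeral_2_eq_2 numeral_3_eq_3)
  then show "8 / 9 * s 2 \<le> alt_sum m (\<lambda>j. s (j + 2))"
    and "alt_sum m (\<lambda>j. s (j + 2)) \<le> s 2"
    and "0 < m \<Longrightarrow> alt_sum m (\<lambda>j. s (j + 2)) < s 2"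
    using alt_sum_geometric_bounds[of m "\<lambda>j. s (j + 2)"] quotients_between_pos[OF q]
    by (simp_all add: numeral_2_eq_2)
qed

section \<open>Signs at the inner points and at the two critical points\<close>

text \<open>Up to the sign, with \<open>t (k - 1) = t (k + 1) = w\<close> the centre contributes
  \<open>t k - 2 * w\<close>. The terms on each side, read outwards from \<open>t (k - 2)\<close>
  and \<open>t (k + 2)\<close>, contribute at least 8/9 of their first term, and \<beta> bounds
  these first terms below by \<open>w / (\<beta> * r)\<close>, where
  \<open>r = t k / w\<close>.\<close>

lemma inner_sign:
  fixes t :: "nat \<Rightarrow> real"
  assumes q: "quotients_between \<alpha> \<beta> n t" and k: "2 \<le> k" "k + 2 \<le> n"
    and \<alpha>: "16 / 5 \<le> \<alpha>" "\<alpha> < 4" and \<beta>: "\<beta> * (\<alpha> * (4 - \<alpha>)) = 8"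
    and eq: "t (k - 1) = t (k + 1)"
  shows "0 < (-1) ^ k * alt_sum n t"
proof -
  obtain l where l: "k = l + 2" using k by (metis add.commute le_Suc_ex)
  obtain m where m: "n = k + m + 2" using k by (metis add.commute add.left_commute le_Suc_ex)
  define w where "w = t (k + 1)"
  define r where "r = t k / w"
  have w: "0 < w" "t (k + 1) = w" "t (k - 1) = w" "t (l + 1) = w"
    using quotients_between_pos[OF q] m eq by (auto simp: w_def l)
  have tk: "0 < t k" "t k = r * w" "0 < r"
    using quotients_between_pos[OF q] m w by (auto simp: r_def)
  have "\<alpha> * (w * w) \<le> (r * w)\<^sup>2"
    using quotients_between_lower[OF q, of "l + 1"] w tk m l by (simp add: numeral_2_eq_2 numeral_3_eq_3)
  then have "\<alpha> * (w * w) \<le> r\<^sup>2 * (w * w)" by (simp add: power2_eq_square algebra_simps)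
  then have r2: "\<alpha> \<le> r\<^sup>2" using w by simp
  \<comment> \<open>1.7 squared is 2.89, below 16/5. This bound makes the factor
    \<open>2 / 9 * (r\<^sup>2 + 2 * r) - 1\<close> in \<open>key\<close> positive.\<close>
  have r1: "1.7 < r"
    by (rule power_less_imp_less_base[of _ 2]) (use r2 \<alpha> tk in \<open>auto simp: power2_eq_square\<close>)
  have \<beta>0: "0 < \<beta>"
    using zero_less_mult_pos2[of \<beta> "\<alpha> * (4 - \<alpha>)"] \<alpha> \<beta> by simp
  have up: "w / (\<beta> * r) \<le> t (k + 2)"
  proof -
    have "w * w \<le> w * (\<beta> * r * t (k + 2))"
      using quotients_between_upper[OF q, of k] w tk m by (simp add: power2_eq_square algebra_simps)
    then have "w \<le> \<beta> * r * t (k + 2)" using w by simp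
    then show ?thesis using \<beta>0 tk by (simp add: field_simps)
  qed
  have lo: "w / (\<beta> * r) \<le> t l"
  proof -
    have "w * w \<le> w * (\<beta> * r * t l)"
      using quotients_between_upper[OF q, of l] w tk m l by (simp add: power2_eq_square algebra_simps)
    then have "w \<le> \<beta> * r * t l" using w by simp
    then show ?thesis using \<beta>0 tk by (simp add: field_simps)
  qed
  have key: "0 < r - 2 + 16 / 9 * (1 / (\<beta> * r))"
  proof (cases "2 \<le> r")
    case True
    then show ?thesis using \<beta>0 tk by (simp add: add_nonneg_pos)
  next
    case False
    have b: "1 / \<beta> = \<alpha> * (4 - \<alpha>) / 8" using \<beta> \<beta>0 by (simp add: field_simps)
    \<comment> \<open>s (4 - s) decreases for s \<ge> 2, so \<open>r\<^sup>2\<close> in place of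
      \<alpha> gives a lower bound for 1/\<beta>. What remains is an inequality in \<open>r\<close>
      alone with the factor \<open>2 - r\<close>.\<close>
    have "0 \<le> (r\<^sup>2 - \<alpha>) * (r\<^sup>2 + \<alpha> - 4)" using r2 \<alpha> by simp
    then have "r\<^sup>2 * (4 - r\<^sup>2) \<le> \<alpha> * (4 - \<alpha>)" by (simp add: algebra_simps)
    then have "r\<^sup>2 * (4 - r\<^sup>2) / 8 \<le> 1 / \<beta>" using b by simp
    then have "r\<^sup>2 * (4 - r\<^sup>2) / 8 / r \<le> 1 / \<beta> / r" using tk by (intro divide_right_mono) auto
    then have "r * (4 - r\<^sup>2) / 8 \<le> 1 / (\<beta> * r)" using tk by (simp add: power2_eq_square)
    moreover have "0 < (2 - r) * (2 / 9 * (r\<^sup>2 + 2 * r) - 1)"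
      using False r1 r2 \<alpha> by (intro mult_pos_pos) auto
    moreover have "r - 2 + 16 / 9 * (r * (4 - r\<^sup>2) / 8) = (2 - r) * (2 / 9 * (r\<^sup>2 + 2 * r) - 1)"
      by (simp add: power2_eq_square field_simps)
    ultimately show ?thesis by linarith
  qed
  have wk: "w \<le> t k" using tk r1 w by simp
  have U: "8 / 9 * t (k + 2) \<le> alt_sum m (\<lambda>j. t (k + (j + 2)))"
    using alt_sum_tail_bounds(1)[of \<alpha> \<beta> m "\<lambda>j. t (k + j)"] quotients_between_shift[of \<alpha> \<beta> k "m + 2" t]
      q m \<alpha> w wk by (simp add: add.assoc)
  \<comment> \<open>Read backwards, the lower indices form a tail of a sequence starting at
    \<open>t k\<close>.\<close>
  have L: "8 / 9 * t l \<le> alt_sum l (\<lambda>j. t (l - j))"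
    using alt_sum_tail_bounds(1)[of \<alpha> \<beta> l "\<lambda>j. t (l + 2 - j)"]
      quotients_between_rev[OF quotients_between_take[of \<alpha> \<beta> "l + 2" "m + 2" t]]
      q m l \<alpha> w wk by (simp add: add.assoc)
  have "alt_sum n t = alt_sum l t + (-1) ^ Suc l * alt_sum (m + 3) (\<lambda>j. t (Suc l + j))"
    using alt_sum_add[of l "m + 3" t] m l by (simp add: eval_nat_numeral)
  moreover have "alt_sum (m + 3) (\<lambda>j. t (Suc l + j))
      = t (k - 1) - t k + t (k + 1) - alt_sum m (\<lambda>j. t (k + (j + 2)))"
    by (simp add: alt_sum_Suc l numeral_3_eq_3 add.commute)
  ultimately have "(-1) ^ k * alt_sum n t
      = alt_sum l (\<lambda>j. t (l - j)) + t k - 2 * w + alt_sum m (\<lambda>j. t (k + (j + 2)))"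
    using w by (cases "even l") (simp_all add: alt_sum_rev l)
  moreover have "w * (r - 2 + 16 / 9 * (1 / (\<beta> * r))) \<le> t k - 2 * w + 8 / 9 * t l + 8 / 9 * t (k + 2)"
    using up lo tk by (simp add: algebra_simps)
  moreover have "0 < w * (r - 2 + 16 / 9 * (1 / (\<beta> * r)))" using key w by simp
  ultimately show ?thesis using U L by linarith
qed

text \<open>In units of \<open>t 1\<close> the terms 2 and 3 are \<open>u\<close> and
  \<open>v\<close>, while \<alpha> bounds the terms 0 and 4 by \<open>1 / (\<alpha> * u)\<close> and
  \<open>v\<^sup>2 / (\<alpha> * u)\<close>. From index 4 on the alternating terms sum to at most
  \<open>t 4\<close>, and to strictly less if n \<ge> 5.\<close>

lemma end_sign:
  fixes t :: "nat \<Rightarrow> real"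
  assumes q: "quotients_between \<alpha> \<beta> n t" and n: "4 \<le> n"
    and \<alpha>: "3 \<le> \<alpha>" "\<alpha> < 4" and \<beta>: "\<beta> * (\<alpha> * (4 - \<alpha>)) = 8"
    and u: "0 < u" "u < 1" "u\<^sup>2 + \<beta> = \<alpha> * \<beta> * u / 2" and eq: "t 2 = u * t 1"
  shows "alt_sum n t \<le> 0" and "5 \<le> n \<Longrightarrow> alt_sum n t < 0"
proof -
  obtain m where m: "n = m + 4" using n by (metis add.commute le_Suc_ex)
  have p: "0 < t 0" "0 < t 1" "0 < t 2" "0 < t 3" "0 < t 4"
    using quotients_between_pos[OF q] n by auto
  have \<beta>0: "0 < \<beta>"
    using zero_less_mult_pos2[of \<beta> "\<alpha> * (4 - \<alpha>)"] \<alpha> \<beta> by simp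
  define v where "v = t 3 / t 1"
  have t3: "t 3 = v * t 1" and v: "0 < v" using p by (auto simp: v_def)
  have t0: "t 0 \<le> t 1 / (\<alpha> * u)"
  proof -
    have "t 1 * (t 0 * (\<alpha> * u)) \<le> t 1 * t 1"
      using quotients_between_lower[OF q, of 0] n eq
      by (simp add: numeral_2_eq_2 algebra_simps)
    then show ?thesis using p u \<alpha> by (simp add: field_simps)
  qed
  have v_lo: "u\<^sup>2 / \<beta> \<le> v"
  proof -
    have "t 1 * t 1 * u\<^sup>2 \<le> t 1 * t 1 * (\<beta> * v)"
      using quotients_between_upper[OF q, of 1] n eq t3
      by (simp add: eval_nat_numeral algebra_simps)
    then show ?thesis using p \<beta>0 by (simp add: field_simps)
  qed
  have v_up: "\<alpha> * v \<le> u\<^sup>2"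
  proof -
    have "t 1 * t 1 * (\<alpha> * v) \<le> t 1 * t 1 * u\<^sup>2"
      using quotients_between_lower[OF q, of 1] n eq t3
      by (simp add: eval_nat_numeral algebra_simps)
    then show ?thesis using p by simp
  qed
  have t4: "t 4 \<le> t 1 * (v\<^sup>2 / (\<alpha> * u))"
  proof -
    have "t 1 * (t 4 * (\<alpha> * u)) \<le> t 1 * (t 1 * v\<^sup>2)"
      using quotients_between_lower[OF q, of 2] n eq t3
      by (simp add: eval_nat_numeral algebra_simps)
    then show ?thesis using p u \<alpha> by (simp add: field_simps)
  qed
  have key: "0 \<le> 1 - 1 / (\<alpha> * u) - u + v - v\<^sup>2 / (\<alpha> * u)"
  proof -
    \<comment> \<open>\<open>e\<close> is the lower bound for \<open>v\<close>. In \<open>v\<close>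
      the expression is a concave parabola with vertex \<open>\<alpha> * u / 2\<close>, so
      \<open>v + e \<le> \<alpha> * u\<close> makes its value at \<open>v\<close> at least the one
      at \<open>e\<close>. There it vanishes: it equals minus the square of
      \<open>1 - \<alpha> * u / 2 + u\<^sup>2 / \<beta>\<close>, divided by
      \<open>\<alpha> * u\<close>, and \<open>u\<close> is a zero of this quadratic.\<close>
    define e where "e = u\<^sup>2 / \<beta>"
    have "u\<^sup>2 \<le> u" using u by (simp add: power2_eq_square)
    moreover have "2 * v \<le> 3 * v" "3 * v \<le> \<alpha> * v" using \<alpha> v by auto
    ultimately have "2 * v \<le> u" using v_up by linarith
    moreover have "u \<le> \<alpha> * u / 2" using u \<alpha> by simp
    ultimately have "v + e \<le> \<alpha> * u" using v_lo u(1) unfolding e_def by linarith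
    then have "0 \<le> (v - e) * (\<alpha> * u - (v + e))" using v_lo by (simp add: e_def)
    then have mono: "\<alpha> * u * e - e\<^sup>2 \<le> \<alpha> * u * v - v\<^sup>2"
      by (simp add: algebra_simps power2_eq_square)
    have e: "\<beta> * e = u\<^sup>2" "1 + e = \<alpha> * u / 2"
      using \<beta>0 u by (auto simp: e_def field_simps)
    have "\<beta> * (\<alpha> * u - 1 - \<alpha> * u\<^sup>2 + \<alpha> * u * e - e\<^sup>2)
        = \<beta> * (\<alpha> * u * (1 + e) - (1 + e)\<^sup>2) + 2 * (\<beta> * e) - \<alpha> * \<beta> * u\<^sup>2"
      by (simp add: algebra_simps power2_eq_square)
    \<comment> \<open>vanishing discriminant: this is where the upper bound \<open>\<beta>\<close> comes from\<close>
    also have "\<dots> = u\<^sup>2 * (8 - \<beta> * (\<alpha> * (4 - \<alpha>))) / 4"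
      unfolding e by (simp add: algebra_simps power2_eq_square)
    finally have "\<alpha> * u - 1 - \<alpha> * u\<^sup>2 + \<alpha> * u * e - e\<^sup>2 = 0"
      using \<beta> \<beta>0 by simp
    then have "0 \<le> (\<alpha> * u - 1 - \<alpha> * u\<^sup>2 + \<alpha> * u * v - v\<^sup>2) / (\<alpha> * u)"
      using mono u \<alpha> by simp
    also have "\<dots> = 1 - 1 / (\<alpha> * u) - u + v - v\<^sup>2 / (\<alpha> * u)"
      using u \<alpha> by (simp add: field_simps power2_eq_square)
    finally show ?thesis .
  qed
  have "0 \<le> t 1 * (1 - 1 / (\<alpha> * u) - u + v - v\<^sup>2 / (\<alpha> * u))" using key p by simp
  also have "\<dots> \<le> t 1 - t 0 - t 2 + t 3 - t 4"
    using t0 t4 eq t3 by (simp add: algebra_simps)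
  finally have head: "t 0 - t 1 + t 2 - t 3 + t 4 \<le> 0" by simp
  \<comment> \<open>The initial condition of the tail bounds, which are applied to the sequence from
    index 2 on.\<close>
  have t32: "t 3 \<le> t 2"
  proof -
    have "u\<^sup>2 \<le> u" using u by (simp add: power2_eq_square)
    moreover have "v \<le> \<alpha> * v" using \<alpha> v by simp
    ultimately have "v \<le> u" using v_up by linarith
    then show ?thesis using eq t3 p by simp
  qed
  have q': "quotients_between \<alpha> \<beta> (m + 2) (\<lambda>j. t (2 + j))"
  proof (rule quotients_between_shift)
    show "quotients_between \<alpha> \<beta> (2 + (m + 2)) t" using q unfolding m by (simp add: eval_nat_numeral)
  qed
  have tail: "alt_sum m (\<lambda>j. t (2 + (j + 2))) \<le> t 4"
    "0 < m \<Longrightarrow> alt_sum m (\<lambda>j. t (2 + (j + 2))) < t 4"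
    using alt_sum_tail_bounds(2,3)[OF q' \<alpha>(1)] t32 by auto
  have "alt_sum n t = t 0 - t 1 + t 2 - t 3 + alt_sum m (\<lambda>j. t (2 + (j + 2)))"
    by (simp add: m alt_sum_Suc eval_nat_numeral)
  then show "alt_sum n t \<le> 0" and "5 \<le> n \<Longrightarrow> alt_sum n t < 0"
    using head tail m by auto
qed

section \<open>Sign changes, quadratic factors and parabolas\<close>

text \<open>The intermediate value theorem puts a zero into each of the \<open>m\<close> disjoint
  gaps.\<close>

lemma sign_changes_le_degree:
  fixes p :: "real poly"
  assumes "p \<noteq> 0" and less: "\<And>k. k < m \<Longrightarrow> y k < y (Suc k)"
    and sign: "\<And>k. k \<le> m \<Longrightarrow> 0 < (-1) ^ k * poly p (y k)"
  shows "m \<le> degree p"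
proof -
  have "\<exists>x. y k < x \<and> x < y (Suc k) \<and> poly p x = 0" if "k < m" for k
  proof -
    have "0 < ((-1) ^ k * poly p (y k)) * ((-1) ^ Suc k * poly p (y (Suc k)))"
      using sign[of k] sign[of "Suc k"] that by (simp only: mult_pos_pos Suc_leI less_imp_le)
    then have "poly p (y k) * poly p (y (Suc k)) < 0"
      by (cases "even k") (simp_all add: mult_less_0_iff zero_less_mult_iff)
    then show ?thesis using poly_IVT[OF less[OF that]] by blast
  qed
  then obtain r where r: "\<And>k. k < m \<Longrightarrow> y k < r k \<and> r k < y (Suc k) \<and> poly p (r k) = 0"
    by metis
  have mono: "y i \<le> y j" if "i \<le> j" "j \<le> m" for i j
    using that
  proof (induction j rule: dec_induct)
    case (step j)
    then show ?case using less[of j] by simp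
  qed simp
  have "r i < r j" if "i < j" "j < m" for i j
    using r[of i] r[of j] mono[of "Suc i" j] that by force
  then have "inj_on r {..<m}"
    unfolding inj_on_def by (metis lessThan_iff less_irrefl nat_neq_iff)
  then have "m = card (r ` {..<m})" by (simp add: card_image)
  also have "\<dots> \<le> card {x. poly p x = 0}"
    using r poly_roots_finite[OF \<open>p \<noteq> 0\<close>] by (intro card_mono) auto
  also have "\<dots> \<le> degree p" using \<open>p \<noteq> 0\<close> by (rule card_poly_roots_bound)
  finally show ?thesis .
qed

text \<open>\<open>D\<close> is (x - z)(x - conj z). The remainder of \<open>P\<close> modulo
  \<open>D\<close> is real, of degree at most 1, and vanishes at the nonreal \<open>z\<close>, hence
  is zero.\<close>

lemma nonreal_root_factor:
  fixes P :: "real poly" and z :: complex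
  assumes "poly (map_poly complex_of_real P) z = 0" and "z \<notin> \<real>"
  obtains D R where "P = D * R" "degree D = 2" "lead_coeff D = 1" "\<And>x. 0 < poly D x"
proof -
  define D where "D = [:(Re z)\<^sup>2 + (Im z)\<^sup>2, - 2 * Re z, 1:]"
  have Im: "Im z \<noteq> 0" using assms(2) by (simp add: complex_is_Real_iff)
  have deg: "degree D = 2" "D \<noteq> 0" "lead_coeff D = 1" by (auto simp: D_def)
  have "poly (map_poly complex_of_real D) z = 0"
    by (simp add: D_def complex_eq_iff power2_eq_square algebra_simps map_poly_pCons)
  moreover have "map_poly complex_of_real P
      = map_poly complex_of_real D * map_poly complex_of_real (P div D) + map_poly complex_of_real (P mod D)"
  proof -
    have "map_poly complex_of_real (A * B + C)
        = map_poly complex_of_real A * map_poly complex_of_real B + map_poly complex_of_real C" for A B C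
      by (rule poly_eqI) (simp add: coeff_map_poly coeff_mult)
    then show ?thesis by (metis mult_div_mod_eq)
  qed
  ultimately have "poly (map_poly complex_of_real (P mod D)) z = 0"
    using assms(1) by simp
  moreover have "degree (P mod D) < 2"
    using degree_mod_less[OF deg(2), of P] deg by auto
  then have "P mod D = [:coeff (P mod D) 0, coeff (P mod D) 1:]"
    by (intro poly_eqI) (auto simp: coeff_pCons coeff_eq_0 split: nat.splits)
  then obtain r s where rs: "P mod D = [:r, s:]" by blast
  ultimately have "of_real r + z * of_real s = 0" by (simp add: map_poly_pCons)
  then have "r = 0 \<and> s = 0" using Im by (auto simp: complex_eq_iff)
  then have "P = D * (P div D)" using rs mult_div_mod_eq[of D P] by simp
  moreover have "0 < poly D x" for x
  proof -
    have "poly D x = (x - Re z)\<^sup>2 + (Im z)\<^sup>2"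
      by (simp add: D_def power2_eq_square algebra_simps)
    then show ?thesis using Im by (simp add: add_nonneg_pos)
  qed
  ultimately show ?thesis using that deg by blast
qed

text \<open>Strict convexity, in the form of an identity: the second divided difference of a
  quadratic is its leading coefficient.\<close>

lemma quadratic_pos_outside:
  fixes R :: "real poly"
  assumes "degree R = 2" "0 < coeff R 2" "x < y" "y < z" "0 < poly R y"
  shows "0 < poly R x \<or> 0 < poly R z"
proof (rule ccontr)
  assume neg: "\<not> ?thesis"
  have R: "poly R x = coeff R 0 + coeff R 1 * x + coeff R 2 * x\<^sup>2" for x
    unfolding poly_altdef assms(1) by (simp add: eval_nat_numeral)
  have "(z - x) * poly R y = (z - y) * poly R x + (y - x) * poly R z
      - coeff R 2 * ((y - x) * (z - y) * (z - x))"
    unfolding R by (simp add: algebra_simps power2_eq_square)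
  moreover have "(z - y) * poly R x \<le> 0" "(y - x) * poly R z \<le> 0"
    using neg assms by (auto intro!: mult_nonneg_nonpos)
  moreover have "0 < (z - x) * poly R y" "0 < coeff R 2 * ((y - x) * (z - y) * (z - x))"
    using assms by auto
  ultimately show False by linarith
qed

section \<open>Construction of the alternating points, and hyperbolicity\<close>

lemma alternating_points:
  fixes a :: "nat \<Rightarrow> real"
  assumes q: "quotients_between \<alpha> \<beta> n a" and n: "4 \<le> n"
    and \<alpha>: "16 / 5 \<le> \<alpha>" "\<alpha> < 4" and \<beta>: "\<beta> = 8 / (\<alpha> * (4 - \<alpha>))"
  obtains y where "\<And>k. k < n - 1 \<Longrightarrow> y k < y (Suc k)"
    and "\<And>k. k \<le> n - 1 \<Longrightarrow> 0 \<le> (-1) ^ k * alt_sum n (\<lambda>j. a j * y k ^ j)"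
    and "\<And>k. k \<le> n - 1 \<Longrightarrow> 5 \<le> n \<or> 2 \<le> k \<and> k + 2 \<le> n \<Longrightarrow> 0 < (-1) ^ k * alt_sum n (\<lambda>j. a j * y k ^ j)"
proof -
  have \<beta>': "\<beta> * (\<alpha> * (4 - \<alpha>)) = 8" using \<alpha> \<beta> by simp
  have "0 \<le> (\<alpha> - 2)\<^sup>2" by simp
  then have "\<alpha> * (4 - \<alpha>) \<le> 4" by (simp add: power2_eq_square algebra_simps)
  then have \<beta>2: "2 \<le> \<beta>" using \<alpha> by (simp add: \<beta> pos_le_divide_eq)
  \<comment> \<open>The quadratic below is \<beta> > 0 at 0, and it is negative at 1 exactly when
    \<beta> (\<alpha> - 2) > 2.\<close>
  have "2 * (6 / 5) \<le> \<beta> * (\<alpha> - 2)" using \<beta>2 \<alpha> by (intro mult_mono) auto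
  then have "\<exists>u. 0 < u \<and> u < 1 \<and> poly [:\<beta>, - (\<alpha> * \<beta> / 2), 1:] u = 0"
    using \<beta>2 by (intro poly_IVT_neg) (auto simp: algebra_simps)
  then obtain u where u: "0 < u" "u < 1" "u\<^sup>2 + \<beta> = \<alpha> * \<beta> * u / 2"
    by (auto simp: power2_eq_square algebra_simps)
  have pos: "0 < a j" if "j \<le> n" for j using quotients_between_pos[OF q that] .
  define p where "p k = a (k - 1) / a k" for k
  \<comment> \<open>The inner points make the terms of index k - 1 and k + 1 equal. The last point,
    \<open>p (n - 1) / u\<close>, corresponds to the first critical one under reversal of the
    coefficients. At 0 only the constant term survives.\<close>
  define y where "y k = (if k = 0 then 0 else if k = 1 then u * a 1 / a 2
      else if k = n - 1 then a (n - 2) / (u * a (n - 1)) else sqrt (a (k - 1) / a (k + 1)))" for k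
  have y0: "y 0 = 0" and y1: "y 1 = u * p 2" and yl: "y (n - 1) = p (n - 1) / u"
    using n by (auto simp: y_def p_def numeral_2_eq_2)
  have ym: "y k = sqrt (p k * p (k + 1))" if "2 \<le> k" "k + 2 \<le> n" for k
    using n that pos[of k] by (auto simp: y_def p_def numeral_2_eq_2)
  have p_pos: "0 < p k" if "1 \<le> k" "k \<le> n" for k
    using pos[of k] pos[of "k - 1"] that by (simp add: p_def)
  have p_less: "p k < p (k + 1)" if k: "1 \<le> k" "k < n" for k
  proof -
    obtain i where i: "k = i + 1" using k by (metis add.commute le_Suc_ex)
    have "a i * a (i + 2) < \<alpha> * (a i * a (i + 2))"
      using \<alpha> pos[of i] pos[of "i + 2"] i k by simp
    also have "\<dots> \<le> (a (i + 1))\<^sup>2" using quotients_between_lower[OF q, of i] i k by simp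
    finally show ?thesis
      using pos[of "i + 1"] pos[of "i + 2"] i k by (simp add: p_def field_simps power2_eq_square)
  qed
  \<comment> \<open>Together with \<open>above\<close> this makes \<open>p (k + 1)\<close> separate
    \<open>y k\<close> from \<open>y (k + 1)\<close>, whichever formulas define the two
    points.\<close>
  have below: "y k < p (k + 1)" if "1 \<le> k" "k + 2 \<le> n" for k
  proof (cases "k = 1")
    case True
    then show ?thesis using y1 u p_pos[of 2] n by (simp add: numeral_2_eq_2)
  next
    case False
    have "p k * p (k + 1) < (p (k + 1))\<^sup>2"
      using p_less[of k] p_pos[of "k + 1"] that by (simp add: power2_eq_square)
    then show ?thesis
      using ym[of k] p_pos[of "k + 1"] p_pos[of k] that False by (simp add: real_less_lsqrt)
  qed
  have above: "p k < y k" if "2 \<le> k" "k + 1 \<le> n" for k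
  proof (cases "k = n - 1")
    case True
    then show ?thesis using yl u p_pos[of "n - 1"] n by (simp add: pos_less_divide_eq)
  next
    case False
    have "(p k)\<^sup>2 < p k * p (k + 1)"
      using p_less[of k] p_pos[of k] that by (simp add: power2_eq_square)
    then show ?thesis
      using ym[of k] that False by (simp add: real_less_rsqrt)
  qed
  have increasing: "y k < y (Suc k)" if "k < n - 1" for k
  proof (cases "k = 0")
    case True
    then show ?thesis using y0 y1 u p_pos[of 2] n by simp
  next
    case False
    then have "y k < p (k + 1)" "p (k + 1) < y (k + 1)" using below[of k] above[of "k + 1"] that by auto
    then show ?thesis by simp
  qed
  have y_pos: "0 < y k" if "1 \<le> k" "k \<le> n - 1" for k
    using that
  proof (induction k rule: dec_induct)
    case base
    then show ?case using y0 increasing[of 0] n by simp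
  next
    case (step k)
    then show ?case using increasing[of k] by simp
  qed
  have scale: "quotients_between \<alpha> \<beta> n (\<lambda>j. a j * y k ^ j)" if "1 \<le> k" "k \<le> n - 1" for k
    using quotients_between_scale[OF q y_pos[OF that]] .
  have inner: "0 < (-1) ^ k * alt_sum n (\<lambda>j. a j * y k ^ j)" if k: "2 \<le> k" "k + 2 \<le> n" for k
  proof (rule inner_sign[OF scale k \<alpha> \<beta>'])
    have "(y k)\<^sup>2 = p k * p (k + 1)" using ym[OF k] p_pos[of k] p_pos[of "k + 1"] k by simp
    also have "\<dots> = a (k - 1) / a (k + 1)" using pos[of k] k by (simp add: p_def)
    finally have "a (k - 1) = a (k + 1) * (y k)\<^sup>2" using pos[of "k + 1"] k by simp
    moreover have "y k ^ (k + 1) = (y k)\<^sup>2 * y k ^ (k - 1)"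
      using k by (simp flip: power_add)
    ultimately show "a (k - 1) * y k ^ (k - 1) = a (k + 1) * y k ^ (k + 1)" by simp
  qed (use k in auto)
  have \<alpha>3: "3 \<le> \<alpha>" using \<alpha> by simp
  have first: "a 2 * y 1 ^ 2 = u * (a 1 * y 1 ^ 1)"
    using pos[of 2] n y1 by (simp add: p_def power2_eq_square)
  have last: "a (n - 2) * y (n - 1) ^ (n - 2) = u * (a (n - 1) * y (n - 1) ^ (n - 1))"
  proof -
    have "n - 1 = Suc (n - 2)" using n by simp
    then show ?thesis using pos[of "n - 1"] n yl u by (simp add: p_def numeral_2_eq_2)
  qed
  \<comment> \<open>Reversal costs the sign (-1)^n = - (-1)^(n - 1), which turns the upper bound of
    \<open>end_sign\<close> into the lower bound wanted at \<open>y (n - 1)\<close>.\<close>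
  have rev: "alt_sum n (\<lambda>j. a (n - j) * y (n - 1) ^ (n - j))
      = - ((-1) ^ (n - 1) * alt_sum n (\<lambda>j. a j * y (n - 1) ^ j))"
    using alt_sum_rev[of n "\<lambda>j. a j * y (n - 1) ^ j"] n by (simp add: power_eq_if)
  note first_sign = end_sign[OF scale n \<alpha>3 \<alpha>(2) \<beta>' u first]
  note last_sign = end_sign[OF quotients_between_rev[OF scale] n \<alpha>3 \<alpha>(2) \<beta>' u last, unfolded rev]
  have zero: "0 < alt_sum n (\<lambda>j. a j * y 0 ^ j)"
    using pos[of 0] n y0 by (simp add: alt_sum_def power_0_left if_distrib cong: if_cong)
  have cases: "k = 0 \<or> k = 1 \<or> k = n - 1 \<or> 2 \<le> k \<and> k + 2 \<le> n" if "k \<le> n - 1" for k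
    using that by linarith
  show ?thesis
  proof (rule that)
    show "y k < y (Suc k)" if "k < n - 1" for k using increasing[OF that] .
    show "0 \<le> (-1) ^ k * alt_sum n (\<lambda>j. a j * y k ^ j)" if "k \<le> n - 1" for k
      using cases[OF that] zero first_sign(1) last_sign(1) inner[of k] n by auto
    show "0 < (-1) ^ k * alt_sum n (\<lambda>j. a j * y k ^ j)"
      if "k \<le> n - 1" "5 \<le> n \<or> 2 \<le> k \<and> k + 2 \<le> n" for k
      using cases[OF that(1)] that(2) zero first_sign(2) last_sign(2) inner[of k] n by auto
  qed
qed

theorem theorem2p1:
  fixes P :: "real poly" and n :: nat
  assumes "n \<ge> 4"
    and "degree P = n"
    and "\<forall>k\<in>{0..n}. coeff P k > 0"
    and "\<exists>\<alpha>::real. 1 + sqrt 5 \<le> \<alpha> \<and> \<alpha> < 4 \<and>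
           (\<forall>k\<in>{2..n}. second_quotient P k \<in> {\<alpha> .. 8 / (\<alpha> * (4 - \<alpha>))})"
  shows "hyperbolic P"
proof -
  obtain \<alpha> where \<alpha>: "1 + sqrt 5 \<le> \<alpha>" "\<alpha> < 4"
    and sq: "\<And>k. k \<in> {2..n} \<Longrightarrow> second_quotient P k \<in> {\<alpha> .. 8 / (\<alpha> * (4 - \<alpha>))}"
    using assms(4) by blast
  define \<beta> where "\<beta> = 8 / (\<alpha> * (4 - \<alpha>))"
  \<comment> \<open>Trades 1 + sqrt 5 for the rational bound 16/5.\<close>
  have "11 / 5 \<le> sqrt 5" by (rule real_le_rsqrt) (simp add: power2_eq_square)
  then have \<alpha>': "16 / 5 \<le> \<alpha>" using \<alpha> by simp
  have "quotients_between \<alpha> \<beta> n (coeff P)"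
    unfolding quotients_between_def
  proof (intro conjI allI impI)
    show "0 < coeff P j" if "j \<le> n" for j using assms(3) that by simp
    fix j assume j: "j + 2 \<le> n"
    have "0 < coeff P j * coeff P (j + 2)" using assms(3) j by simp
    then show "\<alpha> * (coeff P j * coeff P (j + 2)) \<le> (coeff P (j + 1))\<^sup>2"
      and "(coeff P (j + 1))\<^sup>2 \<le> \<beta> * (coeff P j * coeff P (j + 2))"
      using sq[of "j + 2"] j
      by (simp_all add: second_quotient_def pos_le_divide_eq pos_divide_le_eq flip: \<beta>_def)
  qed
  then obtain y where y: "\<And>k. k < n - 1 \<Longrightarrow> y k < y (Suc k)"
    and weak: "\<And>k. k \<le> n - 1 \<Longrightarrow> 0 \<le> (-1) ^ k * alt_sum n (\<lambda>j. coeff P j * y k ^ j)"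
    and strict: "\<And>k. k \<le> n - 1 \<Longrightarrow> 5 \<le> n \<or> 2 \<le> k \<and> k + 2 \<le> n
      \<Longrightarrow> 0 < (-1) ^ k * alt_sum n (\<lambda>j. coeff P j * y k ^ j)"
    by (rule alternating_points[OF _ assms(1) \<alpha>' \<alpha>(2) \<beta>_def]) blast
  have poly: "alt_sum n (\<lambda>j. coeff P j * x ^ j) = poly P (- x)" for x
    unfolding poly_altdef alt_sum_def assms(2)
    by (rule sum.cong) (simp_all add: power_minus[of x])
  show ?thesis
    unfolding hyperbolic_def
  proof (intro allI impI, rule ccontr)
    fix z assume "poly (map_poly complex_of_real P) z = 0" "z \<notin> \<real>"
    then obtain D R where DR: "P = D * R" "degree D = 2" "lead_coeff D = 1"
      and D: "\<And>x. 0 < poly D x"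
      using nonreal_root_factor by blast
    have "P \<noteq> 0" using assms(1,2) by auto
    then have R: "R \<noteq> 0" "degree R = n - 2" using DR assms(2) by (auto simp: degree_mult_eq)
    \<comment> \<open>\<open>D\<close> is positive on the real line, so \<open>R\<close> inherits
      the signs of \<open>P\<close>.\<close>
    have weakR: "0 \<le> (-1) ^ k * poly R (- y k)" if "k \<le> n - 1" for k
    proof -
      have "0 \<le> poly D (- y k) * ((-1) ^ k * poly R (- y k))"
        using weak[OF that] poly DR(1) by (simp add: mult.left_commute)
      then show ?thesis using D[of "- y k"] by (simp add: zero_le_mult_iff)
    qed
    have strictR: "0 < (-1) ^ k * poly R (- y k)" if "k \<le> n - 1" "5 \<le> n \<or> 2 \<le> k \<and> k + 2 \<le> n" for k
    proof -
      have "0 < poly D (- y k) * ((-1) ^ k * poly R (- y k))"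
        using strict[OF that] poly DR(1) by (simp add: mult.left_commute)
      then show ?thesis using D[of "- y k"] by (simp add: zero_less_mult_iff)
    qed
    show False
    proof (cases "n = 4")
      case True
      have "0 < coeff P n" using assms(3) by simp
      then have "0 < coeff R 2"
        using DR R True assms(2) by (metis lead_coeff_mult mult_1 numeral_Bit0 add_diff_cancel_left')
      moreover have "poly R (- y 1) \<le> 0" "poly R (- y 3) \<le> 0" "0 < poly R (- y 2)"
        using weakR[of 1] weakR[of 3] strictR[of 2] True by simp_all
      moreover have "y 1 < y 2" "y 2 < y 3"
        using y[of 1] y[of 2] True by (simp_all add: eval_nat_numeral)
      ultimately show False
        using quadratic_pos_outside[of R "- y 3" "- y 2" "- y 1"] R True by auto
    next
      case False
      \<comment> \<open>Composition with -x makes the \<open>y k\<close> themselves the test points.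
        All \<open>n\<close> signs are strict here, so there are n - 1 changes against degree n -
        2.\<close>
      then have "n - 1 \<le> degree (pcompose R [:0, -1:])"
        using R y strictR assms(1)
        by (intro sign_changes_le_degree[of _ _ y])
           (auto simp: poly_pcompose pcompose_eq_0_iff)
      then show False using R assms(1) by (simp add: degree_pcompose)
    qed
  qed
qed

end
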